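(* Let $\hat P^G,\hat f,\hat\theta,\hat\pi,\hat\gamma^+,\hat\gamma^-,\hat\rho^+,\hat\rho^-,\hat z$ be an arbitrary optimal primal solution and $\hat p$ an arbitrary optimal Lagrangian dual solution of the Combined Model with demand $P^D$, and set $\widehat{LME}_i=\hat p_{\pi,i}+\hat p_o\hat\pi_i$ and $\widehat{LMP}_i=\hat\pi_i$ for $i\in N$. Then for every generator $g\in G$, $\hat P^G_g$ is an optimal solution of the decentralized generation problem of generator $g$ with pricing parameters $\widehat{LMP}$ and $\widehat{LME}$; that is, $\hat P^G_g\in P^{G*}_g:=\operatorname{argmin}_{P^{min}_g\le P_g\le P^{max}_g}(c_g-\widehat{LMP}_g)P_g$ and $\hat P^G_g$ minimizes $(\sigma_g-\widehat{LME}_g)P_g$ over $P_g\in P^{G*}_g$.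
   Context: **Data.** $N$ is a finite set of nodes, $G$ a finite set of generators, $G_i\subseteq G$ the set of generators at node $i$ (each generator lies at exactly one node), and $L$ a finite set of directed lines $\ell=(i,j)$ with admittance $B_\ell=B_{ij}$. Real parameters: costs $c_g$, unit emissions $\sigma_g$, generation limits $P^{min}_g,P^{max}_g$, flow limits $f^{max}_\ell$, demands $P^D_i$. A nodal quantity subscripted by a generator $g$ means its value at the node where $g$ is located (e.g. $LME_g:=LME_i$ for $g\in G_i$). **DC-OPF.** Minimize $c^TP^G$ over $(P^G,\theta,f)$ subject to $B_{ij}(\theta_i-\theta_j)-f_\ell=0$ for $\ell=(i,j)\in L$; $\sum_{g\in G_i}P^G_g-\sum_{\ell=(i,j)\in L}f_\ell+\sum_{\ell=(j,i)\in L}f_\ell-P^D_i=0$ for $i\in N$; $f_\ell\le f^{max}_\ell$ and $f_\ell\ge -f^{max}_\ell$ for $\ell\in L$; $P^G_g\le P^{max}_g$ and $P^G_g\ge P^{min}_g$ for $g\in G$. **Combined Model.** Minimize $\sigma^TP^G$ over $(P^G,\theta,f,\pi,\gamma^+,\gamma^-,\rho^+,\rho^-,z)$ subject to all DC-OPF constraints above together with the DC-OPF dual constraints $\gamma^+_g+\gamma^-_g+\sum_{i\mid g\in G_i}\pi_i=c_g$ ($g\in G$); $-z_\ell+\rho^+_\ell+\rho^-_\ell-\pi_i+\pi_j=0$ ($\ell=(i,j)\in L$); $\sum_{\ell=(i,j)\in L}B_\ell z_\ell-\sum_{\ell=(j,i)\in L}B_\ell z_\ell=0$ ($i\in N$);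 $\rho^+,\gamma^+\le 0$; $\rho^-,\gamma^-\ge0$; and the strong duality constraint $c^TP^G-\pi^TP^D-(\rho^+-\rho^-)^Tf^{max}-(\gamma^+)^TP^{max}-(\gamma^-)^TP^{min}\le 0$. **Multipliers.** $p$ denotes a Lagrangian dual solution of this linear program, with Lagrangian equal to the objective minus the sum of multiplier times (left side minus right side), so multipliers of $\le$ constraints are $\le0$, of $\ge$ constraints are $\ge0$, and of equalities are free. $p_{\pi,i}$ is the multiplier of the flow balance constraint at node $i$, and $p_o$ that of the strong duality constraint. *)

theory Defs
  imports Complex_Main "HOL-Library.Extended_Real"
begin

text \<open>Vectors indexed by nodes, generators or lines are total functions; only their values on the
  finite index sets \<^term>\<open>nodes net\<close>, \<^term>\<open>gens net\<close>, \<^term>\<open>lines net\<close> are ever used.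
  A directed line is the pair of its start and end node.\<close>

record ('n, 'g) network =
  nodes :: "'n set"
  gens :: "'g set"
  gens_at :: "'n \<Rightarrow> 'g set"
  lines :: "('n \<times> 'n) set"
  adm :: "'n \<times> 'n \<Rightarrow> real"
  cost :: "'g \<Rightarrow> real"
  emis :: "'g \<Rightarrow> real"
  Pmin :: "'g \<Rightarrow> real"
  Pmax :: "'g \<Rightarrow> real"
  fmax :: "'n \<times> 'n \<Rightarrow> real"
  demand :: "'n \<Rightarrow> real"

definition wf_network :: "('n, 'g) network \<Rightarrow> bool" where
  "wf_network net \<longleftrightarrow>
     finite (nodes net) \<and> finite (gens net) \<and>
     lines net \<subseteq> nodes net \<times> nodes net \<and>
     (\<forall>i\<in>nodes net. gens_at net i \<subseteq> gens net) \<and>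
     (\<forall>g\<in>gens net. \<exists>!i. i \<in> nodes net \<and> g \<in> gens_at net i)"

definition node_of :: "('n, 'g) network \<Rightarrow> 'g \<Rightarrow> 'n" where
  "node_of net g = (THE i. i \<in> nodes net \<and> g \<in> gens_at net i)"

definition lines_out :: "('n, 'g) network \<Rightarrow> 'n \<Rightarrow> ('n \<times> 'n) set" where
  "lines_out net i = {l \<in> lines net. fst l = i}"

definition lines_in :: "('n, 'g) network \<Rightarrow> 'n \<Rightarrow> ('n \<times> 'n) set" where
  "lines_in net i = {l \<in> lines net. snd l = i}"

record ('n, 'g) opf_var =
  PG :: "'g \<Rightarrow> real"
  theta :: "'n \<Rightarrow> real"
  flow :: "'n \<times> 'n \<Rightarrow> real"

text \<open>The suffixes \<open>_up\<close> and \<open>_lo\<close> stand for the superscripts + and - (upper and lower limits).\<close>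

record ('n, 'g) cm_var = "('n, 'g) opf_var" +
  price :: "'n \<Rightarrow> real"   \<comment> \<open>the variable \<open>\<pi>\<close>\<close>
  gamma_up :: "'g \<Rightarrow> real"
  gamma_lo :: "'g \<Rightarrow> real"
  rho_up :: "'n \<times> 'n \<Rightarrow> real"
  rho_lo :: "'n \<times> 'n \<Rightarrow> real"
  zvar :: "'n \<times> 'n \<Rightarrow> real"

text \<open>Left-hand sides of the DC-OPF equality constraints (right-hand sides are zero).\<close>

definition flow_lhs :: "('n, 'g) network \<Rightarrow> ('n, 'g, 'z) opf_var_scheme \<Rightarrow> 'n \<times> 'n \<Rightarrow> real" where
  "flow_lhs net x l = adm net l * (theta x (fst l) - theta x (snd l)) - flow x l"

definition balance_lhs :: "('n, 'g) network \<Rightarrow> ('n, 'g, 'z) opf_var_scheme \<Rightarrow> 'n \<Rightarrow> real" where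
  "balance_lhs net x i =
     (\<Sum>g\<in>gens_at net i. PG x g) - (\<Sum>l\<in>lines_out net i. flow x l)
       + (\<Sum>l\<in>lines_in net i. flow x l) - demand net i"

definition opf_feasible :: "('n, 'g) network \<Rightarrow> ('n, 'g, 'z) opf_var_scheme \<Rightarrow> bool" where
  "opf_feasible net x \<longleftrightarrow>
     (\<forall>l\<in>lines net. flow_lhs net x l = 0) \<and>
     (\<forall>i\<in>nodes net. balance_lhs net x i = 0) \<and>
     (\<forall>l\<in>lines net. flow x l \<le> fmax net l \<and> flow x l \<ge> - fmax net l) \<and>
     (\<forall>g\<in>gens net. PG x g \<le> Pmax net g \<and> PG x g \<ge> Pmin net g)"

text \<open>Left-hand sides of the DC-OPF dual constraints belonging to the variables \<open>P\<^sup>G\<close>, \<open>f\<close>, \<open>\<theta>\<close>,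
  and of the strong duality constraint.\<close>

definition dual_PG_lhs :: "('n, 'g) network \<Rightarrow> ('n, 'g) cm_var \<Rightarrow> 'g \<Rightarrow> real" where
  "dual_PG_lhs net x g =
     gamma_up x g + gamma_lo x g + (\<Sum>i\<in>{i \<in> nodes net. g \<in> gens_at net i}. price x i)"

definition dual_flow_lhs :: "('n, 'g) cm_var \<Rightarrow> 'n \<times> 'n \<Rightarrow> real" where
  "dual_flow_lhs x l =
     - zvar x l + rho_up x l + rho_lo x l - price x (fst l) + price x (snd l)"

definition dual_theta_lhs :: "('n, 'g) network \<Rightarrow> ('n, 'g) cm_var \<Rightarrow> 'n \<Rightarrow> real" where
  "dual_theta_lhs net x i =
     (\<Sum>l\<in>lines_out net i. adm net l * zvar x l) - (\<Sum>l\<in>lines_in net i. adm net l * zvar x l)"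

definition strong_duality_lhs :: "('n, 'g) network \<Rightarrow> ('n, 'g) cm_var \<Rightarrow> real" where
  "strong_duality_lhs net x =
     (\<Sum>g\<in>gens net. cost net g * PG x g)
     - (\<Sum>i\<in>nodes net. price x i * demand net i)
     - (\<Sum>l\<in>lines net. (rho_up x l - rho_lo x l) * fmax net l)
     - (\<Sum>g\<in>gens net. gamma_up x g * Pmax net g)
     - (\<Sum>g\<in>gens net. gamma_lo x g * Pmin net g)"

definition opf_dual_feasible :: "('n, 'g) network \<Rightarrow> ('n, 'g) cm_var \<Rightarrow> bool" where
  "opf_dual_feasible net x \<longleftrightarrow>
     (\<forall>g\<in>gens net. dual_PG_lhs net x g = cost net g) \<and>
     (\<forall>l\<in>lines net. dual_flow_lhs x l = 0) \<and>
     (\<forall>i\<in>nodes net. dual_theta_lhs net x i = 0) \<and>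
     (\<forall>l\<in>lines net. rho_up x l \<le> 0 \<and> rho_lo x l \<ge> 0) \<and>
     (\<forall>g\<in>gens net. gamma_up x g \<le> 0 \<and> gamma_lo x g \<ge> 0)"

definition cm_feasible :: "('n, 'g) network \<Rightarrow> ('n, 'g) cm_var \<Rightarrow> bool" where
  "cm_feasible net x \<longleftrightarrow>
     opf_feasible net x \<and> opf_dual_feasible net x \<and> strong_duality_lhs net x \<le> 0"

definition cm_objective :: "('n, 'g) network \<Rightarrow> ('n, 'g) cm_var \<Rightarrow> real" where
  "cm_objective net x = (\<Sum>g\<in>gens net. emis net g * PG x g)"

definition cm_optimal :: "('n, 'g) network \<Rightarrow> ('n, 'g) cm_var \<Rightarrow> bool" where
  "cm_optimal net x \<longleftrightarrow> is_arg_min (cm_objective net) (cm_feasible net) x"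

text \<open>One multiplier for every constraint of the Combined Model, including the sign
  constraints on \<open>\<rho>\<close> and \<open>\<gamma>\<close>; \<open>p_pi\<close> belongs to the flow balance
  and \<open>p_o\<close> to the strong duality constraint.\<close>

record ('n, 'g) cm_mult =
  p_flow :: "'n \<times> 'n \<Rightarrow> real"
  p_pi :: "'n \<Rightarrow> real"
  p_f_up :: "'n \<times> 'n \<Rightarrow> real"
  p_f_lo :: "'n \<times> 'n \<Rightarrow> real"
  p_P_up :: "'g \<Rightarrow> real"
  p_P_lo :: "'g \<Rightarrow> real"
  p_dual_PG :: "'g \<Rightarrow> real"
  p_dual_flow :: "'n \<times> 'n \<Rightarrow> real"
  p_dual_theta :: "'n \<Rightarrow> real"
  p_rho_up :: "'n \<times> 'n \<Rightarrow> real"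
  p_rho_lo :: "'n \<times> 'n \<Rightarrow> real"
  p_gamma_up :: "'g \<Rightarrow> real"
  p_gamma_lo :: "'g \<Rightarrow> real"
  p_o :: real

definition cm_lagrangian :: "('n, 'g) network \<Rightarrow> ('n, 'g) cm_mult \<Rightarrow> ('n, 'g) cm_var \<Rightarrow> real" where
  "cm_lagrangian net p x = cm_objective net x -
     ((\<Sum>l\<in>lines net. p_flow p l * flow_lhs net x l)
      + (\<Sum>i\<in>nodes net. p_pi p i * balance_lhs net x i)
      + (\<Sum>l\<in>lines net. p_f_up p l * (flow x l - fmax net l))
      + (\<Sum>l\<in>lines net. p_f_lo p l * (flow x l - (- fmax net l)))
      + (\<Sum>g\<in>gens net. p_P_up p g * (PG x g - Pmax net g))
      + (\<Sum>g\<in>gens net. p_P_lo p g * (PG x g - Pmin net g))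
      + (\<Sum>g\<in>gens net. p_dual_PG p g * (dual_PG_lhs net x g - cost net g))
      + (\<Sum>l\<in>lines net. p_dual_flow p l * dual_flow_lhs x l)
      + (\<Sum>i\<in>nodes net. p_dual_theta p i * dual_theta_lhs net x i)
      + (\<Sum>l\<in>lines net. p_rho_up p l * rho_up x l)
      + (\<Sum>l\<in>lines net. p_rho_lo p l * rho_lo x l)
      + (\<Sum>g\<in>gens net. p_gamma_up p g * gamma_up x g)
      + (\<Sum>g\<in>gens net. p_gamma_lo p g * gamma_lo x g)
      + p_o p * strong_duality_lhs net x)"

definition mult_signs :: "('n, 'g) network \<Rightarrow> ('n, 'g) cm_mult \<Rightarrow> bool" where
  "mult_signs net p \<longleftrightarrow>
     (\<forall>l\<in>lines net. p_f_up p l \<le> 0 \<and> p_f_lo p l \<ge> 0 \<and> p_rho_up p l \<le> 0 \<and> p_rho_lo p l \<ge> 0) \<and>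
     (\<forall>g\<in>gens net. p_P_up p g \<le> 0 \<and> p_P_lo p g \<ge> 0 \<and> p_gamma_up p g \<le> 0 \<and> p_gamma_lo p g \<ge> 0) \<and>
     p_o p \<le> 0"

text \<open>The dual function takes the value \<open>-\<infinity>\<close> where the Lagrangian is unbounded below.\<close>

definition cm_dual_fun :: "('n, 'g) network \<Rightarrow> ('n, 'g) cm_mult \<Rightarrow> ereal" where
  "cm_dual_fun net p = (INF x. ereal (cm_lagrangian net p x))"

definition cm_dual_optimal :: "('n, 'g) network \<Rightarrow> ('n, 'g) cm_mult \<Rightarrow> bool" where
  "cm_dual_optimal net p \<longleftrightarrow> is_arg_max (cm_dual_fun net) (mult_signs net) p"

definition cost_opt_gen :: "('n, 'g) network \<Rightarrow> ('n \<Rightarrow> real) \<Rightarrow> 'g \<Rightarrow> real set" where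
  "cost_opt_gen net LMP g =
     {P. is_arg_min (\<lambda>P. (cost net g - LMP (node_of net g)) * P)
           (\<lambda>P. Pmin net g \<le> P \<and> P \<le> Pmax net g) P}"

definition decentralized_opt ::
    "('n, 'g) network \<Rightarrow> ('n \<Rightarrow> real) \<Rightarrow> ('n \<Rightarrow> real) \<Rightarrow> 'g \<Rightarrow> real \<Rightarrow> bool" where
  "decentralized_opt net LMP LME g P \<longleftrightarrow>
     is_arg_min (\<lambda>P. (emis net g - LME (node_of net g)) * P) (\<lambda>P. P \<in> cost_opt_gen net LMP g) P"

end

theory Submission
  imports Defs
begin

text \<open>
  The first claim is complementary slackness for DC-OPF. A feasible point of the Combined Model is
  a primal-dual pair of DC-OPF without duality gap; the gap is a sum of nonnegative products of
  dual variables and slacks (\<open>strong_duality_lhs_eq_slack\<close>), so each product vanishes. Since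
  \<open>c\<^sub>g - \<pi>\<^sub>i = \<gamma>\<^sup>+\<^sub>g + \<gamma>\<^sup>-\<^sub>g\<close>, generator \<open>g\<close> sits at a bound favoured by its reduced cost.

  The second claim is complementary slackness for the Combined Model itself. As that program
  attains its optimum, linear programming duality gives a multiplier whose dual value is the
  optimal emission, so every dual solution \<open>p\<close> has this value: the Lagrangian at \<open>p\<close> is
  nowhere below the optimal emission (\<open>lagrangian_ge_optimal_emission\<close>). Write \<open>\<mu>\<close> for the
  multiplier of the flow balance at the node of \<open>g\<close>. Moving the output of the single generator \<open>g\<close>
  from \<open>P\<close> to \<open>P'\<close> within its limits yields \<open>(\<sigma>\<^sub>g - \<mu> - p\<^sub>o c\<^sub>g) (P' - P) \<ge> 0\<close>, since the part of
  the Lagrangian due to the limits of \<open>g\<close> vanishes at \<open>P\<close> and is nonpositive at \<open>P'\<close>. The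
  coefficient differs from \<open>\<sigma>\<^sub>g - LME\<^sub>g\<close> by \<open>p\<^sub>o (c\<^sub>g - \<pi>\<^sub>i)\<close>, and \<open>(c\<^sub>g - \<pi>\<^sub>i) (P' - P)\<close> is
  zero when \<open>P'\<close> is cost optimal too.

  Linear programming duality is derived from an algebraic form of Farkas' lemma, whose proof by
  induction on the number of inequalities involves neither topology nor a finite dimension. It asks
  of the underlying space only an operation \<open>v + c w\<close>, which records of functions possess.
\<close>

section \<open>Farkas' lemma and linear programming duality\<close>

text \<open>
  If the last inequality is needed, there is a \<open>w\<close> violating the conclusion that satisfies all
  others, so \<open>a k w > 0\<close>. Projecting along \<open>w\<close> onto the kernel of \<open>a k\<close> eliminates that
  inequality; the sign of its multiplier comes from evaluating the resulting identity at \<open>w\<close>.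
\<close>

lemma farkas:
  fixes a :: "'k \<Rightarrow> 'v \<Rightarrow> real" and b :: "'v \<Rightarrow> real" and cmb :: "'v \<Rightarrow> real \<Rightarrow> 'v \<Rightarrow> 'v"
  assumes "finite I"
    and "\<And>k v c w. k \<in> I \<Longrightarrow> a k (cmb v c w) = a k v + c * a k w"
    and "\<And>v c w. b (cmb v c w) = b v + c * b w"
    and "\<And>v. \<forall>k\<in>I. a k v \<le> 0 \<Longrightarrow> b v \<le> 0"
  shows "\<exists>q. (\<forall>k\<in>I. q k \<ge> 0) \<and> (\<forall>v. b v = (\<Sum>k\<in>I. q k * a k v))"
  using assms
proof (induction I arbitrary: a b rule: finite_induct)
  case empty
  have "b v = 0" for v
    \<comment> \<open>here \<open>v - 2 v\<close> plays the part of \<open>- v\<close>\<close>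
    using empty.prems(2)[of v "-2" v] empty.prems(3)[of v] empty.prems(3)[of "cmb v (-2) v"] by simp
  then show ?case by simp
next
  case (insert k I)
  show ?case
  proof (cases "\<forall>v. (\<forall>i\<in>I. a i v \<le> 0) \<longrightarrow> b v \<le> 0")
    case True
    have "\<exists>q. (\<forall>i\<in>I. q i \<ge> 0) \<and> (\<forall>v. b v = (\<Sum>i\<in>I. q i * a i v))"
      using insert.prems True by (intro insert.IH) auto
    then obtain q where q: "\<forall>i\<in>I. q i \<ge> 0" "\<forall>v. b v = (\<Sum>i\<in>I. q i * a i v)" by blast
    have "(\<Sum>i\<in>I. (q(k := 0)) i * a i v) = (\<Sum>i\<in>I. q i * a i v)" for v
      using insert.hyps by (intro sum.cong) auto
    then show ?thesis using q insert.hyps by (intro exI[of _ "q(k := 0)"]) simp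
  next
    case False
    then obtain w where w: "\<forall>i\<in>I. a i w \<le> 0" "b w > 0" by force
    then have kw: "a k w > 0" using insert.prems(3)[of w] by force
    define pr where "pr v = cmb v (- (a k v / a k w)) w" for v
    have a_pr: "a i (pr v) = a i v - a k v / a k w * a i w" if "i \<in> insert k I" for i v
      unfolding pr_def using insert.prems(1)[OF that] by simp
    have b_pr: "b (pr v) = b v - a k v / a k w * b w" for v
      unfolding pr_def using insert.prems(2) by simp
    have "\<exists>q. (\<forall>i\<in>I. q i \<ge> 0) \<and> (\<forall>v. b (pr v) = (\<Sum>i\<in>I. q i * a i (pr v)))"
    proof (rule insert.IH)
      show "a i (pr (cmb v c u)) = a i (pr v) + c * a i (pr u)" if "i \<in> I" for i v c u
        using that kw by (simp add: a_pr insert.prems(1) field_simps)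
      show "b (pr (cmb v c u)) = b (pr v) + c * b (pr u)" for v c u
        using kw by (simp add: b_pr insert.prems(1,2) field_simps)
      show "b (pr v) \<le> 0" if "\<forall>i\<in>I. a i (pr v) \<le> 0" for v
      proof (rule insert.prems(3))
        have "a k (pr v) = 0" using kw by (simp add: a_pr)
        then show "\<forall>i\<in>insert k I. a i (pr v) \<le> 0" using that by simp
      qed
    qed
    then obtain q where q: "\<forall>i\<in>I. q i \<ge> 0" "\<And>v. b (pr v) = (\<Sum>i\<in>I. q i * a i (pr v))" by blast
    define r where "r = (b w - (\<Sum>i\<in>I. q i * a i w)) / a k w"
    have "(\<Sum>i\<in>I. q i * a i w) \<le> 0"
      using q(1) w(1) by (intro sum_nonpos) (simp add: mult_nonneg_nonpos)
    then have "r \<ge> 0" using w kw by (simp add: r_def)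
    moreover have "b v = (\<Sum>i\<in>I. q i * a i v) + r * a k v" for v
    proof -
      have "(\<Sum>i\<in>I. q i * a i (pr v)) = (\<Sum>i\<in>I. q i * a i v - a k v / a k w * (q i * a i w))"
        by (intro sum.cong) (simp_all add: a_pr algebra_simps)
      also have "\<dots> = (\<Sum>i\<in>I. q i * a i v) - a k v / a k w * (\<Sum>i\<in>I. q i * a i w)"
        by (simp add: sum_subtractf sum_distrib_left)
      finally show ?thesis using q(2)[of v] b_pr[of v] kw
        by (simp add: r_def field_simps)
    qed
    moreover have "(\<Sum>i\<in>I. (q(k := r)) i * a i v) = (\<Sum>i\<in>I. q i * a i v)" for v
      using insert.hyps by (intro sum.cong) auto
    ultimately show ?thesis using q(1) insert.hyps by (intro exI[of _ "q(k := r)"]) simp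
  qed
qed

text \<open>
  Homogenisation: a pair \<open>(v, t)\<close> stands for the point \<open>v / t\<close>, and \<open>g v - g z + t * g z\<close> is the
  linear functional on pairs that extends an affine \<open>g\<close>, where \<open>z\<close> is the origin. The inequality
  \<open>t \<ge> 0\<close>, indexed by \<^const>\<open>None\<close>, must be added. Pairs with \<open>t = 0\<close> are recession directions, and
  there feasibility is what makes Farkas' lemma applicable.
\<close>

lemma affine_lagrange_multipliers:
  fixes g :: "'k \<Rightarrow> 'v \<Rightarrow> real" and f :: "'v \<Rightarrow> real" and cmb :: "'v \<Rightarrow> real \<Rightarrow> 'v \<Rightarrow> 'v"
  assumes "finite I"
    and g_aff: "\<And>k v c w. k \<in> I \<Longrightarrow> g k (cmb v c w) = g k v + c * (g k w - g k z)"
    and f_aff: "\<And>v c w. f (cmb v c w) = f v + c * (f w - f z)"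
    and feas: "\<forall>k\<in>I. g k x \<le> 0"
    and bound: "\<And>v. \<forall>k\<in>I. g k v \<le> 0 \<Longrightarrow> f v \<ge> m"
  shows "\<exists>q. (\<forall>k\<in>I. q k \<ge> 0) \<and> (\<forall>v. f v + (\<Sum>k\<in>I. q k * g k v) \<ge> m)"
proof -
  define hom where "hom h = (\<lambda>(v, t). h v - h z + t * h z)" for h :: "'v \<Rightarrow> real"
  define a where "a k = (case k of None \<Rightarrow> (\<lambda>(v, t). - t) | Some i \<Rightarrow> hom (g i))"
    for k :: "'k option"
  define b where "b u = snd u * m - hom f u" for u
  define cmb2 where "cmb2 u c w = (cmb (fst u) c (fst w), snd u + c * snd w)" for u c w
  have scale: "f (cmb z (1 / t) v) = hom f (v, t) / t"
       "k \<in> I \<Longrightarrow> g k (cmb z (1 / t) v) = hom (g k) (v, t) / t" if "t > 0" for k v t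
    using that by (simp_all add: hom_def f_aff g_aff field_simps)
  have "\<exists>q. (\<forall>k\<in>insert None (Some ` I). q k \<ge> 0)
          \<and> (\<forall>u. b u = (\<Sum>k\<in>insert None (Some ` I). q k * a k u))"
  proof (rule farkas)
    show "finite (insert None (Some ` I))" using \<open>finite I\<close> by simp
    show "a k (cmb2 u c w) = a k u + c * a k w" if "k \<in> insert None (Some ` I)" for k u c w
      using that by (cases u; cases w) (auto simp: a_def cmb2_def hom_def g_aff algebra_simps)
    show "b (cmb2 u c w) = b u + c * b w" for u c w
      by (cases u; cases w) (simp add: b_def cmb2_def hom_def f_aff algebra_simps)
    show "b u \<le> 0" if u: "\<forall>k\<in>insert None (Some ` I). a k u \<le> 0" for u
    proof -
      obtain v t where vt: "u = (v, t)" by (cases u)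
      have t: "t \<ge> 0" and gk: "\<And>k. k \<in> I \<Longrightarrow> hom (g k) (v, t) \<le> 0"
        using u by (auto simp: a_def vt)
      show ?thesis
      proof (cases "t = 0")
        case False
        with t have "t > 0" by simp
        have "f (cmb z (1 / t) v) \<ge> m"
          using gk \<open>t > 0\<close> by (intro bound) (simp add: scale divide_le_0_iff)
        then show ?thesis using \<open>t > 0\<close> by (simp add: scale b_def vt field_simps)
      next
        case True
        have "f v - f z \<ge> 0"
        proof (rule ccontr)
          assume "\<not> f v - f z \<ge> 0"
          then have neg: "f v - f z < 0" by simp
          \<comment> \<open>so far along the direction that \<open>f\<close> falls to \<open>m - 1\<close>\<close>
          define s where "s = (f x - m + 1) / (f z - f v)"
          have "f x \<ge> m" using feas bound by blast
          then have s: "s \<ge> 0" using neg by (simp add: s_def)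
          have "f (cmb x s v) \<ge> m"
          proof (intro bound ballI)
            fix k assume k: "k \<in> I"
            have "s * (g k v - g k z) \<le> 0"
              using gk[OF k] s True by (intro mult_nonneg_nonpos) (auto simp: hom_def)
            then show "g k (cmb x s v) \<le> 0" using feas k by (force simp: g_aff)
          qed
          moreover have "s * (f z - f v) = f x - m + 1" using neg by (simp add: s_def)
          ultimately show False by (simp add: f_aff algebra_simps)
        qed
        then show ?thesis using True by (simp add: b_def vt hom_def)
      qed
    qed
  qed
  then obtain q where q: "\<forall>k\<in>insert None (Some ` I). q k \<ge> 0"
      "\<And>u. b u = (\<Sum>k\<in>insert None (Some ` I). q k * a k u)" by blast
  have "f v + (\<Sum>k\<in>I. q (Some k) * g k v) \<ge> m" for v
  proof -
    have "b (v, 1) = - q None + (\<Sum>k\<in>I. q (Some k) * g k v)"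
      using q(2)[of "(v, 1)"] \<open>finite I\<close> by (simp add: a_def hom_def sum.reindex)
    moreover have "q None \<ge> 0" using q(1) by simp
    ultimately show ?thesis by (simp add: b_def hom_def)
  qed
  then show ?thesis using q(1) by (intro exI[of _ "\<lambda>k. q (Some k)"]) simp
qed

text \<open>
  The duality theorem in the sign convention where multipliers are subtracted. The predicates \<open>le\<close>
  and \<open>ge\<close> say in which directions a constraint restricts; an equation satisfies both, which leaves
  its multiplier free.
\<close>

lemma lp_dual_multipliers:
  fixes r :: "'k \<Rightarrow> 'v \<Rightarrow> real" and f :: "'v \<Rightarrow> real" and cmb :: "'v \<Rightarrow> real \<Rightarrow> 'v \<Rightarrow> 'v"
  assumes "finite K"
    and r_aff: "\<And>k v c w. k \<in> K \<Longrightarrow> r k (cmb v c w) = r k v + c * (r k w - r k z)"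
    and f_aff: "\<And>v c w. f (cmb v c w) = f v + c * (f w - f z)"
    and feas: "\<forall>k\<in>K. (le k \<longrightarrow> r k x \<le> 0) \<and> (ge k \<longrightarrow> r k x \<ge> 0)"
    and bound: "\<And>v. \<forall>k\<in>K. (le k \<longrightarrow> r k v \<le> 0) \<and> (ge k \<longrightarrow> r k v \<ge> 0) \<Longrightarrow> f v \<ge> m"
  shows "\<exists>q. (\<forall>k\<in>K. (\<not> ge k \<longrightarrow> q k \<le> 0) \<and> (\<not> le k \<longrightarrow> q k \<ge> 0))
           \<and> (\<forall>v. f v - (\<Sum>k\<in>K. q k * r k v) \<ge> m)"
proof -
  define S :: "'k \<Rightarrow> real set"
    where "S k = {s. s = 1 \<and> le k \<or> s = - 1 \<and> ge k}" for k
  have S_sub: "S k \<subseteq> {1, - 1}" for k by (auto simp: S_def)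
  have S_fin: "finite (S k)" for k using S_sub by (rule finite_subset) simp
  have S_iff: "(\<forall>j\<in>Sigma K S. snd j * r (fst j) v \<le> 0)
      \<longleftrightarrow> (\<forall>k\<in>K. (le k \<longrightarrow> r k v \<le> 0) \<and> (ge k \<longrightarrow> r k v \<ge> 0))" for v
    by (auto simp: S_def)
  have "\<exists>q. (\<forall>j\<in>Sigma K S. q j \<ge> 0)
          \<and> (\<forall>v. f v + (\<Sum>j\<in>Sigma K S. q j * (snd j * r (fst j) v)) \<ge> m)"
  proof (rule affine_lagrange_multipliers)
    show "finite (Sigma K S)" using \<open>finite K\<close> S_fin by simp
    show "snd j * r (fst j) (cmb v c w)
        = snd j * r (fst j) v + c * (snd j * r (fst j) w - snd j * r (fst j) z)"
      if "j \<in> Sigma K S" for j v c w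
      using that by (auto simp: r_aff algebra_simps)
    show "\<forall>j\<in>Sigma K S. snd j * r (fst j) x \<le> 0" using feas by (simp only: S_iff)
    show "f v \<ge> m" if "\<forall>j\<in>Sigma K S. snd j * r (fst j) v \<le> 0" for v
      using that bound by (simp only: S_iff)
  qed (rule f_aff)
  then obtain q where q: "\<forall>j\<in>Sigma K S. q j \<ge> 0"
      "\<forall>v. f v + (\<Sum>j\<in>Sigma K S. q j * (snd j * r (fst j) v)) \<ge> m" by blast
  define q' where "q' k = - (\<Sum>s\<in>S k. q (k, s) * s)" for k
  have "(\<Sum>j\<in>Sigma K S. q j * (snd j * r (fst j) v)) = - (\<Sum>k\<in>K. q' k * r k v)" for v
  proof -
    have "(\<Sum>j\<in>Sigma K S. q j * (snd j * r (fst j) v))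
        = (\<Sum>k\<in>K. \<Sum>s\<in>S k. q (k, s) * (s * r k v))"
      using \<open>finite K\<close> S_fin by (subst sum.Sigma) (auto simp: case_prod_unfold)
    then show ?thesis
      by (simp add: q'_def sum_distrib_left sum_distrib_right mult_ac flip: sum_negf)
  qed
  moreover have "q' k \<le> 0" if "k \<in> K" "\<not> ge k" for k
    using that q(1) by (auto simp: q'_def S_def intro!: sum_nonneg)
  moreover have "q' k \<ge> 0" if "k \<in> K" "\<not> le k" for k
    using that q(1) by (auto simp: q'_def S_def intro!: sum_nonpos)
  ultimately show ?thesis using q(2) by (intro exI[of _ q']) auto
qed

section \<open>The Combined Model as a single family of constraints\<close>

text \<open>
  Naming the constraints, rather than collecting their left-hand sides in a set, keeps the multipliers
  of coinciding constraints apart.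
\<close>

datatype ('n, 'g) con =
    Flow "'n \<times> 'n" | Balance 'n
  | FlowUp "'n \<times> 'n" | FlowLo "'n \<times> 'n"
  | GenUp 'g | GenLo 'g
  | DualPG 'g | DualFlow "'n \<times> 'n" | DualTheta 'n
  | RhoUp "'n \<times> 'n" | RhoLo "'n \<times> 'n"
  | GammaUp 'g | GammaLo 'g
  | StrongDuality

definition cons :: "('n, 'g) network \<Rightarrow> ('n, 'g) con set" where
  "cons net =
     Flow ` lines net \<union> (Balance ` nodes net
     \<union> (FlowUp ` lines net \<union> (FlowLo ` lines net
     \<union> (GenUp ` gens net \<union> (GenLo ` gens net
     \<union> (DualPG ` gens net \<union> (DualFlow ` lines net \<union> (DualTheta ` nodes net
     \<union> (RhoUp ` lines net \<union> (RhoLo ` lines net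
     \<union> (GammaUp ` gens net \<union> (GammaLo ` gens net
     \<union> {StrongDuality}))))))))))))"

primrec residual :: "('n, 'g) network \<Rightarrow> ('n, 'g) con \<Rightarrow> ('n, 'g) cm_var \<Rightarrow> real" where
  "residual net (Flow l) = (\<lambda>x. flow_lhs net x l)"
| "residual net (Balance i) = (\<lambda>x. balance_lhs net x i)"
| "residual net (FlowUp l) = (\<lambda>x. flow x l - fmax net l)"
| "residual net (FlowLo l) = (\<lambda>x. flow x l - (- fmax net l))"
| "residual net (GenUp g) = (\<lambda>x. PG x g - Pmax net g)"
| "residual net (GenLo g) = (\<lambda>x. PG x g - Pmin net g)"
| "residual net (DualPG g) = (\<lambda>x. dual_PG_lhs net x g - cost net g)"
| "residual net (DualFlow l) = (\<lambda>x. dual_flow_lhs x l)"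
| "residual net (DualTheta i) = (\<lambda>x. dual_theta_lhs net x i)"
| "residual net (RhoUp l) = (\<lambda>x. rho_up x l)"
| "residual net (RhoLo l) = (\<lambda>x. rho_lo x l)"
| "residual net (GammaUp g) = (\<lambda>x. gamma_up x g)"
| "residual net (GammaLo g) = (\<lambda>x. gamma_lo x g)"
| "residual net StrongDuality = (\<lambda>x. strong_duality_lhs net x)"

primrec multiplier :: "('n, 'g) cm_mult \<Rightarrow> ('n, 'g) con \<Rightarrow> real" where
  "multiplier p (Flow l) = p_flow p l"
| "multiplier p (Balance i) = p_pi p i"
| "multiplier p (FlowUp l) = p_f_up p l"
| "multiplier p (FlowLo l) = p_f_lo p l"
| "multiplier p (GenUp g) = p_P_up p g"
| "multiplier p (GenLo g) = p_P_lo p g"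
| "multiplier p (DualPG g) = p_dual_PG p g"
| "multiplier p (DualFlow l) = p_dual_flow p l"
| "multiplier p (DualTheta i) = p_dual_theta p i"
| "multiplier p (RhoUp l) = p_rho_up p l"
| "multiplier p (RhoLo l) = p_rho_lo p l"
| "multiplier p (GammaUp g) = p_gamma_up p g"
| "multiplier p (GammaLo g) = p_gamma_lo p g"
| "multiplier p StrongDuality = p_o p"

definition bounds_above :: "('n, 'g) con \<Rightarrow> bool" where
  "bounds_above k \<longleftrightarrow> (case k of FlowLo _ \<Rightarrow> False | GenLo _ \<Rightarrow> False | RhoLo _ \<Rightarrow> False
     | GammaLo _ \<Rightarrow> False | _ \<Rightarrow> True)"

definition bounds_below :: "('n, 'g) con \<Rightarrow> bool" where
  "bounds_below k \<longleftrightarrow> (case k of FlowUp _ \<Rightarrow> False | GenUp _ \<Rightarrow> False | RhoUp _ \<Rightarrow> False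
     | GammaUp _ \<Rightarrow> False | StrongDuality \<Rightarrow> False | _ \<Rightarrow> True)"

lemma finite_lines: "wf_network net \<Longrightarrow> finite (lines net)"
  unfolding wf_network_def by (meson finite_SigmaI finite_subset)

lemma finite_cons: "wf_network net \<Longrightarrow> finite (cons net)"
  using finite_lines[of net] by (auto simp: cons_def wf_network_def)

lemma cm_feasible_iff_residual:
  "cm_feasible net x \<longleftrightarrow>
     (\<forall>k\<in>cons net. (bounds_above k \<longrightarrow> residual net k x \<le> 0)
        \<and> (bounds_below k \<longrightarrow> residual net k x \<ge> 0))"
  unfolding cons_def cm_feasible_def opf_feasible_def opf_dual_feasible_def ball_Un ball_simps
    bounds_above_def bounds_below_def
  by (simp add: eq_iff) (auto simp: algebra_simps)

lemma mult_signs_iff_multiplier: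
  "mult_signs net p \<longleftrightarrow>
     (\<forall>k\<in>cons net. (\<not> bounds_below k \<longrightarrow> multiplier p k \<le> 0)
        \<and> (\<not> bounds_above k \<longrightarrow> multiplier p k \<ge> 0))"
  unfolding cons_def mult_signs_def ball_Un ball_simps bounds_above_def bounds_below_def
  by auto

lemma cm_lagrangian_eq_residual:
  assumes "wf_network net"
  shows "cm_lagrangian net p x
    = cm_objective net x - (\<Sum>k\<in>cons net. multiplier p k * residual net k x)"
proof -
  have fin: "finite (nodes net)" "finite (gens net)" "finite (lines net)"
    using assms finite_lines by (auto simp: wf_network_def)
  have disj: "A \<inter> B = {} \<Longrightarrow> A \<inter> C = {} \<Longrightarrow> A \<inter> (B \<union> C) = {}" for A B C :: "('n, 'g) con set"
    by blast
  have im: "(\<And>a b. c a \<noteq> d b) \<Longrightarrow> c ` A \<inter> d ` B = {}"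
    for c :: "'x \<Rightarrow> ('n, 'g) con" and d :: "'y \<Rightarrow> ('n, 'g) con" and A B by blast
  show ?thesis unfolding cons_def cm_lagrangian_def
    by (simp add: sum.union_disjoint fin disj im image_iff sum.reindex inj_on_def)
qed

lemma multiplier_surj: "\<exists>p. multiplier p = q"
proof
  show "multiplier \<lparr>p_flow = q \<circ> Flow, p_pi = q \<circ> Balance, p_f_up = q \<circ> FlowUp, p_f_lo = q \<circ> FlowLo,
      p_P_up = q \<circ> GenUp, p_P_lo = q \<circ> GenLo, p_dual_PG = q \<circ> DualPG, p_dual_flow = q \<circ> DualFlow,
      p_dual_theta = q \<circ> DualTheta, p_rho_up = q \<circ> RhoUp, p_rho_lo = q \<circ> RhoLo,
      p_gamma_up = q \<circ> GammaUp, p_gamma_lo = q \<circ> GammaLo, p_o = q StrongDuality\<rparr> = q"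
    (is "multiplier ?p = q")
  proof
    show "multiplier ?p k = q k" for k by (cases k) simp_all
  qed
qed

definition cm_zero :: "('n, 'g) cm_var" where
  "cm_zero = \<lparr>PG = (\<lambda>_. 0), theta = (\<lambda>_. 0), flow = (\<lambda>_. 0), price = (\<lambda>_. 0),
     gamma_up = (\<lambda>_. 0), gamma_lo = (\<lambda>_. 0), rho_up = (\<lambda>_. 0), rho_lo = (\<lambda>_. 0), zvar = (\<lambda>_. 0)\<rparr>"

definition cm_add_scaled :: "('n, 'g) cm_var \<Rightarrow> real \<Rightarrow> ('n, 'g) cm_var \<Rightarrow> ('n, 'g) cm_var" where
  "cm_add_scaled x c y = \<lparr>PG = (\<lambda>g. PG x g + c * PG y g), theta = (\<lambda>i. theta x i + c * theta y i),
     flow = (\<lambda>l. flow x l + c * flow y l), price = (\<lambda>i. price x i + c * price y i),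
     gamma_up = (\<lambda>g. gamma_up x g + c * gamma_up y g),
     gamma_lo = (\<lambda>g. gamma_lo x g + c * gamma_lo y g),
     rho_up = (\<lambda>l. rho_up x l + c * rho_up y l), rho_lo = (\<lambda>l. rho_lo x l + c * rho_lo y l),
     zvar = (\<lambda>l. zvar x l + c * zvar y l)\<rparr>"

lemma cm_objective_affine:
  "cm_objective net (cm_add_scaled x c y)
    = cm_objective net x + c * (cm_objective net y - cm_objective net cm_zero)"
  by (simp add: cm_objective_def cm_add_scaled_def cm_zero_def algebra_simps sum.distrib
      sum_distrib_left)

lemma residual_affine:
  "residual net k (cm_add_scaled x c y)
    = residual net k x + c * (residual net k y - residual net k cm_zero)"
  by (cases k)
    (simp_all add: cm_add_scaled_def cm_zero_def flow_lhs_def balance_lhs_def dual_PG_lhs_def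
      dual_flow_lhs_def dual_theta_lhs_def strong_duality_lhs_def algebra_simps sum.distrib
      sum_subtractf sum_distrib_left)

section \<open>Complementary slackness in the Combined Model\<close>

text \<open>There is no duality gap, whichever optimal multiplier is taken.\<close>

lemma lagrangian_ge_optimal_emission:
  assumes wf: "wf_network net" and x: "cm_optimal net x" and p: "cm_dual_optimal net p"
  shows "cm_lagrangian net p y \<ge> cm_objective net x"
proof -
  have feas: "cm_feasible net x"
    and opt: "\<And>v. cm_feasible net v \<Longrightarrow> cm_objective net v \<ge> cm_objective net x"
    using x by (auto simp: cm_optimal_def is_arg_min_def not_less)
  have "\<exists>q. (\<forall>k\<in>cons net. (\<not> bounds_below k \<longrightarrow> q k \<le> 0) \<and> (\<not> bounds_above k \<longrightarrow> q k \<ge> 0))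
      \<and> (\<forall>v. cm_objective net v - (\<Sum>k\<in>cons net. q k * residual net k v) \<ge> cm_objective net x)"
    using finite_cons[OF wf] residual_affine cm_objective_affine
      feas[unfolded cm_feasible_iff_residual] opt[unfolded cm_feasible_iff_residual]
    by (rule lp_dual_multipliers)
  then obtain q where "mult_signs net q" "\<And>v. cm_lagrangian net q v \<ge> cm_objective net x"
    using multiplier_surj
    unfolding mult_signs_iff_multiplier cm_lagrangian_eq_residual[OF wf] by metis
  then have "cm_dual_fun net q \<ge> ereal (cm_objective net x)"
    by (auto simp: cm_dual_fun_def intro: INF_greatest)
  also have "cm_dual_fun net p \<ge> cm_dual_fun net q"
    using p \<open>mult_signs net q\<close> by (auto simp: cm_dual_optimal_def is_arg_max_def not_less)
  also have "cm_dual_fun net p \<le> ereal (cm_lagrangian net p y)"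
    unfolding cm_dual_fun_def by (rule INF_lower) simp
  finally show ?thesis by simp
qed

text \<open>
  At a feasible point no term of the sum subtracted in the Lagrangian is negative, while the sum
  is at most zero because the Lagrangian is at least the objective there.
\<close>

lemma multiplier_residual_eq_0:
  assumes wf: "wf_network net" and x: "cm_optimal net x" and p: "cm_dual_optimal net p"
    and k: "k \<in> cons net"
  shows "multiplier p k * residual net k x = 0"
proof -
  have "cm_feasible net x" "mult_signs net p"
    using x p by (auto simp: cm_optimal_def is_arg_min_def cm_dual_optimal_def is_arg_max_def)
  then have nonneg: "multiplier p j * residual net j x \<ge> 0" if "j \<in> cons net" for j
    using that unfolding cm_feasible_iff_residual mult_signs_iff_multiplier
    by (cases "bounds_above j"; cases "bounds_below j")
      (fastforce simp: bounds_above_def bounds_below_def split: con.splits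
        intro: mult_nonneg_nonneg mult_nonpos_nonpos)+
  have "(\<Sum>j\<in>cons net. multiplier p j * residual net j x) \<le> 0"
    using lagrangian_ge_optimal_emission[OF wf x p, of x] cm_lagrangian_eq_residual[OF wf, of p x]
    by simp
  then have "(\<Sum>j\<in>cons net. multiplier p j * residual net j x) = 0"
    using nonneg by (intro antisym sum_nonneg) auto
  then show ?thesis using nonneg k finite_cons[OF wf] by (simp add: sum_nonneg_eq_0_iff)
qed

section \<open>Complementary slackness in DC-OPF\<close>

lemma nodes_of_gen:
  assumes "wf_network net" "g \<in> gens net"
  shows "{i \<in> nodes net. g \<in> gens_at net i} = {node_of net g}"
proof -
  have ex1: "\<exists>!i. i \<in> nodes net \<and> g \<in> gens_at net i" using assms by (simp add: wf_network_def)
  from theI'[OF this] have "node_of net g \<in> nodes net \<and> g \<in> gens_at net (node_of net g)"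
    unfolding node_of_def .
  with ex1 show ?thesis by blast
qed

lemma sum_gens_by_node:
  fixes u :: "'n \<Rightarrow> real" and P :: "'g \<Rightarrow> real"
  assumes wf: "wf_network net"
  shows "(\<Sum>i\<in>nodes net. u i * (\<Sum>g\<in>gens_at net i. P g)) = (\<Sum>g\<in>gens net. u (node_of net g) * P g)"
proof -
  have "(\<Sum>i\<in>nodes net. u i * (\<Sum>g\<in>gens_at net i. P g))
      = (\<Sum>i\<in>nodes net. \<Sum>g\<in>{g \<in> gens net. g \<in> gens_at net i}. u i * P g)"
  proof (intro sum.cong refl)
    fix i assume "i \<in> nodes net"
    then have "{g \<in> gens net. g \<in> gens_at net i} = gens_at net i"
      using wf by (auto simp: wf_network_def)
    then show "u i * (\<Sum>g\<in>gens_at net i. P g) = (\<Sum>g\<in>{g \<in> gens net. g \<in> gens_at net i}. u i * P g)"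
      by (simp add: sum_distrib_left)
  qed
  also have "\<dots> = (\<Sum>g\<in>gens net. \<Sum>i\<in>{i \<in> nodes net. g \<in> gens_at net i}. u i * P g)"
    using wf by (intro sum.swap_restrict) (auto simp: wf_network_def)
  also have "\<dots> = (\<Sum>g\<in>gens net. u (node_of net g) * P g)"
    using wf by (intro sum.cong) (simp_all add: nodes_of_gen)
  finally show ?thesis .
qed

lemma sum_lines_by_node:
  fixes u :: "'n \<Rightarrow> real" and h :: "'n \<times> 'n \<Rightarrow> real"
  assumes wf: "wf_network net"
  shows "(\<Sum>i\<in>nodes net. u i * (\<Sum>l\<in>lines_out net i. h l)) = (\<Sum>l\<in>lines net. u (fst l) * h l)"
    and "(\<Sum>i\<in>nodes net. u i * (\<Sum>l\<in>lines_in net i. h l)) = (\<Sum>l\<in>lines net. u (snd l) * h l)"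
proof -
  have group: "(\<Sum>i\<in>nodes net. u i * (\<Sum>l\<in>{l \<in> lines net. e l = i}. h l))
      = (\<Sum>l\<in>lines net. u (e l) * h l)"
    if "e ` lines net \<subseteq> nodes net" for e :: "'n \<times> 'n \<Rightarrow> 'n"
  proof -
    have "finite (lines net)" "finite (nodes net)"
      using wf finite_lines by (auto simp: wf_network_def)
    from sum.group[OF this that, of "\<lambda>l. u (e l) * h l"] show ?thesis
      by (simp add: sum_distrib_left)
  qed
  have "fst ` lines net \<subseteq> nodes net" "snd ` lines net \<subseteq> nodes net"
    using wf by (auto simp: wf_network_def)
  then show "(\<Sum>i\<in>nodes net. u i * (\<Sum>l\<in>lines_out net i. h l)) = (\<Sum>l\<in>lines net. u (fst l) * h l)"
    and "(\<Sum>i\<in>nodes net. u i * (\<Sum>l\<in>lines_in net i. h l)) = (\<Sum>l\<in>lines net. u (snd l) * h l)"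
    unfolding lines_out_def lines_in_def by (simp_all only: group)
qed

text \<open>
  The duality gap of DC-OPF in terms of slacks: the prices cancel by the flow balances, and the
  \<open>z\<close> cancel because the flows come from potentials while \<open>B z\<close> is a circulation.
\<close>

lemma strong_duality_lhs_eq_slack:
  assumes wf: "wf_network net" and P: "opf_feasible net x" and D: "opf_dual_feasible net x"
  shows "strong_duality_lhs net x =
     (\<Sum>g\<in>gens net. gamma_up x g * (PG x g - Pmax net g) + gamma_lo x g * (PG x g - Pmin net g))
   + (\<Sum>l\<in>lines net. rho_up x l * (flow x l - fmax net l) + rho_lo x l * (flow x l + fmax net l))"
proof -
  have cost: "(\<Sum>g\<in>gens net. cost net g * PG x g)
      = (\<Sum>g\<in>gens net. gamma_up x g * PG x g) + (\<Sum>g\<in>gens net. gamma_lo x g * PG x g)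
        + (\<Sum>g\<in>gens net. price x (node_of net g) * PG x g)"
  proof -
    have "cost net g = gamma_up x g + gamma_lo x g + price x (node_of net g)" if "g \<in> gens net" for g
    proof -
      have "dual_PG_lhs net x g = cost net g" using D that by (simp add: opf_dual_feasible_def)
      then show ?thesis using nodes_of_gen[OF wf that] by (simp add: dual_PG_lhs_def)
    qed
    then show ?thesis by (simp add: algebra_simps sum.distrib)
  qed
  have balance: "(\<Sum>g\<in>gens net. price x (node_of net g) * PG x g)
      = (\<Sum>i\<in>nodes net. price x i * demand net i)
        + (\<Sum>l\<in>lines net. (price x (fst l) - price x (snd l)) * flow x l)"
  proof -
    have "(\<Sum>i\<in>nodes net. price x i * balance_lhs net x i) = 0"
      using P by (simp add: opf_feasible_def)
    then show ?thesis
      by (simp add: balance_lhs_def algebra_simps sum.distrib sum_subtractf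
          sum_gens_by_node[OF wf] sum_lines_by_node[OF wf])
  qed
  have circulation: "(\<Sum>l\<in>lines net. zvar x l * flow x l) = 0"
  proof -
    have "(\<Sum>l\<in>lines net. zvar x l * flow x l)
        = (\<Sum>l\<in>lines net. theta x (fst l) * (adm net l * zvar x l)
            - theta x (snd l) * (adm net l * zvar x l))"
      using P by (intro sum.cong) (auto simp: opf_feasible_def flow_lhs_def algebra_simps)
    also have "\<dots> = (\<Sum>i\<in>nodes net. theta x i * dual_theta_lhs net x i)"
      unfolding dual_theta_lhs_def right_diff_distrib sum_subtractf sum_lines_by_node[OF wf] ..
    also have "\<dots> = 0" using D by (simp add: opf_dual_feasible_def)
    finally show ?thesis .
  qed
  have "(\<Sum>l\<in>lines net. (price x (fst l) - price x (snd l)) * flow x l)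
      = (\<Sum>l\<in>lines net. rho_up x l * flow x l + rho_lo x l * flow x l - zvar x l * flow x l)"
  proof (intro sum.cong refl)
    fix l assume "l \<in> lines net"
    then have "price x (fst l) - price x (snd l) = rho_up x l + rho_lo x l - zvar x l"
      using D by (auto simp: opf_dual_feasible_def dual_flow_lhs_def algebra_simps)
    then show "(price x (fst l) - price x (snd l)) * flow x l
        = rho_up x l * flow x l + rho_lo x l * flow x l - zvar x l * flow x l"
      by (simp only: distrib_right left_diff_distrib)
  qed
  also have "\<dots> = (\<Sum>l\<in>lines net. rho_up x l * flow x l) + (\<Sum>l\<in>lines net. rho_lo x l * flow x l)"
    using circulation by (simp add: sum.distrib sum_subtractf)
  finally show ?thesis
    using cost balance
    by (simp add: strong_duality_lhs_def algebra_simps sum.distrib sum_subtractf)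
qed

lemma gamma_slack_eq_0:
  assumes wf: "wf_network net" and x: "cm_feasible net x" and g: "g \<in> gens net"
  shows "gamma_up x g * (PG x g - Pmax net g) = 0" and "gamma_lo x g * (PG x g - Pmin net g) = 0"
proof -
  have P: "opf_feasible net x" and D: "opf_dual_feasible net x" and gap: "strong_duality_lhs net x \<le> 0"
    using x by (auto simp: cm_feasible_def)
  have up: "gamma_up x h * (PG x h - Pmax net h) \<ge> 0"
    and lo: "gamma_lo x h * (PG x h - Pmin net h) \<ge> 0" if "h \<in> gens net" for h
    using P D that by (auto simp: opf_feasible_def opf_dual_feasible_def
        intro: mult_nonneg_nonneg mult_nonpos_nonpos)
  have "rho_up x l * (flow x l - fmax net l) + rho_lo x l * (flow x l + fmax net l) \<ge> 0"
    if "l \<in> lines net" for l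
  proof -
    have "flow x l - fmax net l \<le> 0" "flow x l + fmax net l \<ge> 0" "rho_up x l \<le> 0" "rho_lo x l \<ge> 0"
      using P D that by (force simp: opf_feasible_def opf_dual_feasible_def)+
    then show ?thesis by (simp add: mult_nonpos_nonpos)
  qed
  then have "(\<Sum>l\<in>lines net. rho_up x l * (flow x l - fmax net l)
      + rho_lo x l * (flow x l + fmax net l)) \<ge> 0"
    by (rule sum_nonneg)
  then have "(\<Sum>h\<in>gens net. gamma_up x h * (PG x h - Pmax net h)
      + gamma_lo x h * (PG x h - Pmin net h)) \<le> 0"
    using gap strong_duality_lhs_eq_slack[OF wf P D] by simp
  moreover have "gamma_up x g * (PG x g - Pmax net g) + gamma_lo x g * (PG x g - Pmin net g)
      \<le> (\<Sum>h\<in>gens net. gamma_up x h * (PG x h - Pmax net h)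
      + gamma_lo x h * (PG x h - Pmin net h))"
    using wf g up lo by (intro member_le_sum) (auto simp: wf_network_def)
  ultimately show "gamma_up x g * (PG x g - Pmax net g) = 0"
    and "gamma_lo x g * (PG x g - Pmin net g) = 0"
    using up[OF g] lo[OF g] by linarith+
qed

section \<open>Decentralized generation\<close>

text \<open>
  If multipliers \<open>a\<close> and \<open>b\<close> of an upper and a lower limit are complementary to the slacks at \<open>P\<close>,
  then \<open>P\<close> minimizes the linear function with slope \<open>a + b\<close> between the limits. This serves both for
  costs, with \<open>\<gamma>\<^sup>+\<close> and \<open>\<gamma>\<^sup>-\<close>, and for emissions, with the multipliers of the generation limits.
\<close>

lemma signed_slack_imp_increase:
  fixes a b :: real
  assumes "a \<le> 0" "b \<ge> 0" "a * (P - U) = 0" "b * (P - L) = 0" "L \<le> P'" "P' \<le> U"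
  shows "(a + b) * (P' - P) \<ge> 0"
proof -
  have "(a + b) * (P' - P) = a * (P' - U) + b * (P' - L) - a * (P - U) - b * (P - L)"
    by (simp add: algebra_simps)
  moreover have "a * (P' - U) \<ge> 0" "b * (P' - L) \<ge> 0"
    using assms by (auto intro: mult_nonneg_nonneg mult_nonpos_nonpos)
  ultimately show ?thesis using assms(3,4) by linarith
qed

lemma PG_in_cost_opt_gen:
  assumes wf: "wf_network net" and x: "cm_feasible net x" and g: "g \<in> gens net"
    and LMP: "LMP (node_of net g) = price x (node_of net g)"
  shows "PG x g \<in> cost_opt_gen net LMP g"
proof -
  have "dual_PG_lhs net x g = cost net g"
    using x g by (simp add: cm_feasible_def opf_dual_feasible_def)
  then have red: "cost net g - LMP (node_of net g) = gamma_up x g + gamma_lo x g"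
    using nodes_of_gen[OF wf g] LMP by (simp add: dual_PG_lhs_def)
  have "(gamma_up x g + gamma_lo x g) * (P - PG x g) \<ge> 0"
    if "Pmin net g \<le> P" "P \<le> Pmax net g" for P
    using x g that gamma_slack_eq_0[OF wf x g]
    by (intro signed_slack_imp_increase) (auto simp: cm_feasible_def opf_dual_feasible_def)
  moreover have "Pmin net g \<le> PG x g" "PG x g \<le> Pmax net g"
    using x g by (auto simp: cm_feasible_def opf_feasible_def)
  ultimately show ?thesis
    unfolding cost_opt_gen_def is_arg_min_def red by (fastforce simp: algebra_simps)
qed

lemma cm_lagrangian_change_gen:
  assumes wf: "wf_network net" and g: "g \<in> gens net"
  shows "cm_lagrangian net p (x\<lparr>PG := (PG x)(g := P)\<rparr>) = cm_lagrangian net p x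
    + (emis net g - p_pi p (node_of net g) - p_P_up p g - p_P_lo p g - p_o p * cost net g)
      * (P - PG x g)"
proof -
  define d where "d h = (if h = g then P - PG x g else 0)" for h
  have upd: "(PG x)(g := P) = (\<lambda>h. PG x h + d h)" by (auto simp: d_def)
  have fin: "finite (gens net)" using wf by (simp add: wf_network_def)
  have gens: "(\<Sum>h\<in>gens net. c h * d h) = c g * (P - PG x g)" for c
    using fin g by (simp add: d_def if_distrib[of "\<lambda>t. _ * t"] sum.delta cong: if_cong)
  have nodes: "(\<Sum>i\<in>nodes net. p_pi p i * (\<Sum>h\<in>gens_at net i. d h))
      = p_pi p (node_of net g) * (P - PG x g)"
    by (simp add: sum_gens_by_node[OF wf] gens)
  define y where "y = x\<lparr>PG := \<lambda>h. PG x h + d h\<rparr>"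
  have y: "PG y = (\<lambda>h. PG x h + d h)" "theta y = theta x" "flow y = flow x" "price y = price x"
    "gamma_up y = gamma_up x" "gamma_lo y = gamma_lo x" "rho_up y = rho_up x" "rho_lo y = rho_lo x"
    "zvar y = zvar x" by (simp_all add: y_def)
  have objective: "cm_objective net y = cm_objective net x + emis net g * (P - PG x g)"
    by (simp add: cm_objective_def y distrib_left sum.distrib gens)
  have balance: "(\<Sum>i\<in>nodes net. p_pi p i * balance_lhs net y i)
      = (\<Sum>i\<in>nodes net. p_pi p i * balance_lhs net x i) + p_pi p (node_of net g) * (P - PG x g)"
  proof -
    have "balance_lhs net y i = balance_lhs net x i + (\<Sum>h\<in>gens_at net i. d h)" for i
      by (simp add: balance_lhs_def y sum.distrib)
    then show ?thesis by (simp add: distrib_left sum.distrib nodes)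
  qed
  have limits: "(\<Sum>h\<in>gens net. c h * (PG y h - e h))
      = (\<Sum>h\<in>gens net. c h * (PG x h - e h)) + c g * (P - PG x g)" for c e
  proof -
    have "c h * (PG y h - e h) = c h * (PG x h - e h) + c h * d h" for h
      by (simp add: y algebra_simps)
    then show ?thesis by (simp add: sum.distrib gens)
  qed
  have gap: "strong_duality_lhs net y = strong_duality_lhs net x + cost net g * (P - PG x g)"
    by (simp add: strong_duality_lhs_def y distrib_left sum.distrib gens)
  have unchanged: "flow_lhs net y = flow_lhs net x" "dual_PG_lhs net y = dual_PG_lhs net x"
    "dual_flow_lhs y = dual_flow_lhs x" "dual_theta_lhs net y = dual_theta_lhs net x"
    by (auto simp: y fun_eq_iff flow_lhs_def dual_PG_lhs_def dual_flow_lhs_def dual_theta_lhs_def)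
  show ?thesis
    unfolding upd y_def[symmetric] cm_lagrangian_def objective balance limits gap unchanged y(2-)
    by (simp add: algebra_simps)
qed

text \<open>
  The Lagrangian at \<open>p\<close> equals the optimal emission at \<open>x\<close> and is nowhere smaller, so changing the
  output of \<open>g\<close> alone cannot lower it; the two limits of \<open>g\<close> are then split off by complementarity.
\<close>

lemma emission_rate_increase:
  assumes wf: "wf_network net" and x: "cm_optimal net x" and p: "cm_dual_optimal net p"
    and g: "g \<in> gens net" and P: "Pmin net g \<le> P" "P \<le> Pmax net g"
  shows "(emis net g - p_pi p (node_of net g) - p_o p * cost net g) * (P - PG x g) \<ge> 0"
proof -
  have "cm_lagrangian net p x = cm_objective net x"
    using multiplier_residual_eq_0[OF wf x p]
    by (simp add: cm_lagrangian_eq_residual[OF wf] del: mult_eq_0_iff)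
  then have "(emis net g - p_pi p (node_of net g) - p_P_up p g - p_P_lo p g - p_o p * cost net g)
      * (P - PG x g) \<ge> 0"
    using lagrangian_ge_optimal_emission[OF wf x p, of "x\<lparr>PG := (PG x)(g := P)\<rparr>"]
      cm_lagrangian_change_gen[OF wf g, of p x P] by simp
  moreover have "(p_P_up p g + p_P_lo p g) * (P - PG x g) \<ge> 0"
  proof (rule signed_slack_imp_increase)
    show "p_P_up p g \<le> 0" "p_P_lo p g \<ge> 0"
      using p g by (auto simp: cm_dual_optimal_def is_arg_max_def mult_signs_def)
    show "p_P_up p g * (PG x g - Pmax net g) = 0"
      using multiplier_residual_eq_0[OF wf x p, of "GenUp g"] g by (simp add: cons_def)
    show "p_P_lo p g * (PG x g - Pmin net g) = 0"
      using multiplier_residual_eq_0[OF wf x p, of "GenLo g"] g by (simp add: cons_def)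
  qed (use P in auto)
  ultimately show ?thesis by (simp add: algebra_simps)
qed

theorem theorem4:
  fixes net :: "('n, 'g) network"
    and x :: "('n, 'g) cm_var"
    and p :: "('n, 'g) cm_mult"
    and LMP LME :: "'n \<Rightarrow> real"
  assumes "wf_network net"
    and "cm_optimal net x"
    and "cm_dual_optimal net p"
    and "\<And>i. i \<in> nodes net \<Longrightarrow> LME i = p_pi p i + p_o p * price x i"
    and "\<And>i. i \<in> nodes net \<Longrightarrow> LMP i = price x i"
  shows "\<forall>g\<in>gens net. PG x g \<in> cost_opt_gen net LMP g \<and> decentralized_opt net LMP LME g (PG x g)"
proof
  fix g assume g: "g \<in> gens net"
  let ?i = "node_of net g"
  have "?i \<in> nodes net" using nodes_of_gen[OF assms(1) g] by blast
  then have LME: "LME ?i = p_pi p ?i + p_o p * price x ?i" and LMP: "LMP ?i = price x ?i"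
    using assms(4,5) by auto
  have "cm_feasible net x" using assms(2) by (simp add: cm_optimal_def is_arg_min_def)
  then have opt: "PG x g \<in> cost_opt_gen net LMP g"
    using PG_in_cost_opt_gen[OF assms(1) _ g] LMP by blast
  have "(emis net g - LME ?i) * PG x g \<le> (emis net g - LME ?i) * P"
    if P: "P \<in> cost_opt_gen net LMP g" for P
  proof -
    have same_cost: "(cost net g - price x ?i) * (P - PG x g) = 0"
      using P opt LMP unfolding cost_opt_gen_def is_arg_min_def by (fastforce simp: algebra_simps)
    have "(emis net g - p_pi p ?i - p_o p * cost net g) * (P - PG x g) \<ge> 0"
      using P emission_rate_increase[OF assms(1-3) g] by (simp add: cost_opt_gen_def is_arg_min_def)
    moreover have "(emis net g - LME ?i) * (P - PG x g)
        = (emis net g - p_pi p ?i - p_o p * cost net g) * (P - PG x g)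
          + p_o p * ((cost net g - price x ?i) * (P - PG x g))"
      by (simp add: LME algebra_simps)
    ultimately have "(emis net g - LME ?i) * (P - PG x g) \<ge> 0"
      by (simp only: same_cost mult_zero_right add_0_right)
    then show ?thesis by (simp add: algebra_simps)
  qed
  then have "decentralized_opt net LMP LME g (PG x g)"
    using opt by (auto simp: decentralized_opt_def is_arg_min_def not_less)
  with opt show "PG x g \<in> cost_opt_gen net LMP g \<and> decentralized_opt net LMP LME g (PG x g)" ..
qed

end
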